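(* Let $a,b,c$ be positive real numbers with $a\neq b$, let $x\in\mathbb{R}$, $n\ge 0$ an integer, and $\alpha,\lambda\in\mathbb{C}$. Then $$G_{n}^{(\alpha)}(x;a,b,c;\lambda)=G_{n}^{(\alpha)}\Big(\frac{-\alpha\ln a+x\ln c}{\ln b-\ln a};\lambda\Big)(\ln b-\ln a)^{n-\alpha}.$$
   Context: The generalized Apostol-Genocchi polynomials of order $\alpha$ with parameters $a,b,c$ are defined by $\Big(\frac{2t}{\lambda b^{t}+a^{t}}\Big)^{\alpha}c^{xt}=\sum_{n\ge0}G_{n}^{(\alpha)}(x;a,b,c;\lambda)\frac{t^{n}}{n!}$. The Apostol-Genocchi polynomials of order $\alpha$ are defined by $\Big(\frac{2z}{\lambda e^{z}+1}\Big)^{\alpha}e^{xz}=\sum_{n\ge0}G_{n}^{(\alpha)}(x;\lambda)\frac{z^{n}}{n!}$. *)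

theory Defs
  imports "HOL-Complex_Analysis.Complex_Analysis"
begin

text \<open>
  \<open>has_egf F g\<close>: the generating-function identity \<open>F t = (\<Sum>n. g n * t ^ n / fact n)\<close> holds for all
  sufficiently small real \<open>t \<noteq> 0\<close>. All powers of complex order are principal values (\<open>powr\<close>).
  The point \<open>t = 0\<close> is left out because \<open>2 t / (lam * b powr t + a powr t)\<close> is \<open>0 / 0\<close> there for
  \<open>lam = -1\<close>, and because \<open>0 powr 0 = 0\<close>. The variable is real because for \<open>lam = -1\<close> and \<open>a < b\<close>
  the base is a negative real for every real \<open>t \<noteq> 0\<close>: its principal power is smooth along the real
  line, but jumps in every complex neighbourhood of \<open>0\<close>.
\<close>

definition has_egf :: "(real \<Rightarrow> complex) \<Rightarrow> (nat \<Rightarrow> complex) \<Rightarrow> bool" where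
  "has_egf F g \<longleftrightarrow> (\<forall>\<^sub>F t in at 0. (\<lambda>n. g n * of_real t ^ n / fact n) sums F t)"

text \<open>
  A function has at most one such expansion (\<open>has_egf_unique\<close> below).  If it has none, the
  coefficients are undefined mathematically, and are \<open>0\<close> here by convention.
\<close>

definition egf_coeff :: "(real \<Rightarrow> complex) \<Rightarrow> nat \<Rightarrow> complex" where
  "egf_coeff F n = (if \<exists>g. has_egf F g then (THE g. has_egf F g) n else 0)"

definition gen_apostol_genocchi_gf ::
    "complex \<Rightarrow> complex \<Rightarrow> real \<Rightarrow> real \<Rightarrow> real \<Rightarrow> complex \<Rightarrow> real \<Rightarrow> complex" where
  "gen_apostol_genocchi_gf \<alpha> x a b c lam t =
     (2 * of_real t / (lam * of_real (b powr t) + of_real (a powr t))) powr \<alpha>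
       * of_real c powr (x * of_real t)"

definition gen_apostol_genocchi ::
    "nat \<Rightarrow> complex \<Rightarrow> complex \<Rightarrow> real \<Rightarrow> real \<Rightarrow> real \<Rightarrow> complex \<Rightarrow> complex" where
  "gen_apostol_genocchi n \<alpha> x a b c lam = egf_coeff (gen_apostol_genocchi_gf \<alpha> x a b c lam) n"

definition apostol_genocchi_gf :: "complex \<Rightarrow> complex \<Rightarrow> complex \<Rightarrow> real \<Rightarrow> complex" where
  "apostol_genocchi_gf \<alpha> x lam z =
     (2 * of_real z / (lam * exp (of_real z) + 1)) powr \<alpha> * exp (x * of_real z)"

definition apostol_genocchi :: "nat \<Rightarrow> complex \<Rightarrow> complex \<Rightarrow> complex \<Rightarrow> complex" where
  "apostol_genocchi n \<alpha> x lam = egf_coeff (apostol_genocchi_gf \<alpha> x lam) n"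


lemma has_egf_unique:
  assumes "has_egf F g" "has_egf F h"
  shows "g = h"
proof (rule ccontr)
  assume "g \<noteq> h"
  define d where "d n = (g n - h n) / fact n" for n
  obtain m0 where m0: "d m0 \<noteq> 0"
    using \<open>g \<noteq> h\<close> by (auto simp: d_def fun_eq_iff)
  have "\<forall>\<^sub>F t in at (0::real). (\<lambda>n. d n * of_real t ^ n) sums 0"
    using assms unfolding has_egf_def
  proof eventually_elim
    case (elim t)
    from sums_diff[OF elim] show ?case
      by (simp add: d_def algebra_simps diff_divide_distrib)
  qed
  then obtain r where r: "r > 0"
    and s0: "\<And>t::real. t \<noteq> 0 \<Longrightarrow> \<bar>t\<bar> < r \<Longrightarrow> (\<lambda>n. d n * of_real t ^ n) sums 0"
    by (auto simp: eventually_at dist_norm)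
  define m where "m = (LEAST n. d n \<noteq> 0)"
  have dm: "d m \<noteq> 0" unfolding m_def by (rule LeastI[of "\<lambda>n. d n \<noteq> 0", OF m0])
  have dl: "d n = 0" if "n < m" for n
    using not_less_Least that unfolding m_def by blast
  define e where "e n = d (n + m)" for n
  have e0: "(\<lambda>n. e n * of_real t ^ n) sums 0" if t: "t \<noteq> 0" "\<bar>t\<bar> < r" for t :: real
  proof -
    have "(\<lambda>n. d (n + m) * of_real t ^ (n + m)) sums (0 - (\<Sum>i<m. d i * of_real t ^ i))"
      using s0[OF t] by (rule sums_split_initial_segment)
    also have "(\<Sum>i<m. d i * (of_real t :: complex) ^ i) = 0"
      by (simp add: dl)
    finally have "(\<lambda>n. of_real t ^ m * (e n * of_real t ^ n)) sums (of_real t ^ m * 0)"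
      by (simp add: e_def power_add mult_ac)
    thus ?thesis
      using t by (subst (asm) sums_mult_iff) auto
  qed
  define f where "f z = (\<Sum>n. e n * z ^ n)" for z :: complex
  have sm: "(\<lambda>n. e n * z ^ n) sums f z" if "norm z < r / 2" for z
  proof -
    have "summable (\<lambda>n. e n * of_real (r / 2) ^ n)"
      using e0[of "r / 2"] r by (auto simp: sums_iff)
    hence "summable (\<lambda>n. e n * z ^ n)"
      by (rule powser_inside) (use that r in auto)
    thus ?thesis by (simp add: f_def summable_sums)
  qed
  have "(f \<longlongrightarrow> e 0) (at 0)"
    by (rule powser_limit_0[of "r / 2"]) (use sm r in auto)
  moreover have "filterlim (of_real :: real \<Rightarrow> complex) (at 0) (at 0)"
    unfolding filterlim_at by (auto intro!: tendsto_eq_intros simp: eventually_at_filter)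
  ultimately have "((\<lambda>t::real. f (of_real t)) \<longlongrightarrow> e 0) (at 0)"
    by (rule filterlim_compose)
  moreover have "\<forall>\<^sub>F t in at (0::real). f (of_real t) = 0"
    unfolding eventually_at
  proof (intro exI[of _ "r / 2"] conjI ballI impI)
    fix t :: real assume t: "t \<noteq> 0 \<and> dist t 0 < r / 2"
    show "f (of_real t) = 0"
      using e0[of t] t r by (auto simp: f_def sums_iff)
  qed (use r in auto)
  ultimately have "((\<lambda>t::real. 0 :: complex) \<longlongrightarrow> e 0) (at 0)"
    by (rule Lim_transform_eventually)
  hence "e 0 = 0"
    by (simp add: tendsto_const_iff)
  thus False using dm by (simp add: e_def)
qed

lemma egf_coeff_eqI:
  assumes "has_egf F g"
  shows "egf_coeff F = g"
proof -
  have "(THE g. has_egf F g) = g"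
    by (rule the_equality[of "has_egf F", OF assms has_egf_unique[OF _ assms]])
  with assms show ?thesis
    unfolding egf_coeff_def by (metis (lifting) ext)
qed

lemma has_egf_analytic:
  assumes "f analytic_on {0}" "\<forall>\<^sub>F t in at 0. F t = f (of_real t)"
  shows "\<exists>g. has_egf F g"
proof -
  from assms(1) obtain r where r: "r > 0" "f holomorphic_on ball 0 r"
    by (auto simp: analytic_on_def)
  have "\<forall>\<^sub>F t in at (0::real). norm (of_real t :: complex) < r"
    using r(1) by (auto simp: eventually_at)
  with assms(2)
  have "\<forall>\<^sub>F t in at 0. (\<lambda>n. (deriv ^^ n) f 0 * of_real t ^ n / fact n) sums F t"
  proof eventually_elim
    case (elim t)
    with holomorphic_power_series[OF r(2), of "of_real t"] show ?case
      by simp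
  qed
  thus ?thesis
    unfolding has_egf_def by (intro exI[of _ "\<lambda>n. (deriv ^^ n) f 0"])
qed

lemma gen_apostol_genocchi_gf_standard:
  "gen_apostol_genocchi_gf \<alpha> x 1 (exp 1) (exp 1) lam = apostol_genocchi_gf \<alpha> x lam"
  by (simp add: fun_eq_iff gen_apostol_genocchi_gf_def apostol_genocchi_gf_def powr_def
      Ln_of_real exp_of_real)

text \<open>
  The expansion exists when the order is a natural number, and for every complex order when
  \<open>lam = -1\<close>.
\<close>

lemma gen_apostol_genocchi_expansion:
  assumes "a > 0" "b > 0" "c > 0" "a \<noteq> b" "\<alpha> \<in> \<nat> \<or> lam = -1"
  shows "\<exists>g. has_egf (gen_apostol_genocchi_gf \<alpha> x a b c lam) g"
proof -
  define A where "A = complex_of_real (ln a)"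
  define B where "B = complex_of_real (ln b)"
  have AB: "A \<noteq> B" using assms by (simp add: A_def B_def)
  have pw: "of_real (a powr t) = exp (A * of_real t)" "of_real (b powr t) = exp (B * of_real t)" for t
    using assms by (simp_all add: powr_def A_def B_def exp_of_real mult.commute flip: of_real_mult)
  have cx: "of_real c powr (x * of_real t) = exp (x * of_real (ln c) * of_real t)" for t :: real
    using assms by (simp add: powr_def Ln_of_real mult_ac)
  have gf: "gen_apostol_genocchi_gf \<alpha> x a b c lam t =
     (2 * of_real t / (lam * exp (B * of_real t) + exp (A * of_real t))) powr \<alpha>
       * exp (x * of_real (ln c) * of_real t)" for t
    by (simp add: gen_apostol_genocchi_gf_def pw cx)
  show ?thesis
  proof (cases "lam = -1")
    case False
    with assms obtain m where m: "\<alpha> = of_nat m" by (auto elim: Nats_cases)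
    have "\<forall>\<^sub>F t in at (0::real). lam * exp (B * of_real t) + exp (A * of_real t) \<noteq> 0"
    proof -
      have "((\<lambda>t::real. lam * exp (B * of_real t) + exp (A * of_real t)) \<longlongrightarrow>
               lam * exp (B * of_real 0) + exp (A * of_real 0)) (at 0)"
        by (intro tendsto_intros)
      moreover have "lam * exp (B * of_real 0) + exp (A * of_real 0) \<noteq> 0"
        using False by (simp add: add_eq_0_iff2)
      ultimately show ?thesis by (rule tendsto_imp_eventually_ne)
    qed
    moreover have "\<forall>\<^sub>F t in at (0::real). t \<noteq> 0"
      by (simp add: eventually_at_filter)
    ultimately have ev: "\<forall>\<^sub>F t in at 0. gen_apostol_genocchi_gf \<alpha> x a b c lam t =
        (\<lambda>z. (2 * z / (lam * exp (B * z) + exp (A * z))) ^ m * exp (x * of_real (ln c) * z)) (of_real t)"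
      by eventually_elim (unfold gf, simp add: m powr_nat)
    show ?thesis
      by (rule has_egf_analytic[OF _ ev])
         (use False in \<open>auto intro!: analytic_intros simp: add_eq_0_iff2\<close>)
  next
    case True
    define k where "k = (ln a - ln b) / 2"
    have k: "k \<noteq> 0" using assms by (simp add: k_def)
    have k2: "2 * k = ln a - ln b" by (simp add: k_def)
    define q where "q z = (exp (A * z) - exp (B * z)) / of_real (ln a - ln b)" for z
    define h where "h z = (if z = 0 then 1 else q z / z)" for z
    have dq: "(q has_field_derivative 1) (at 0)"
      unfolding q_def using AB by (auto intro!: derivative_eq_intros simp: A_def B_def)
    have han: "h analytic_on {0}"
    proof (rule pole_theorem_analytic_0[where g = q and a = 0])
      show "q analytic_on {0}"
        unfolding q_def using k k2 by (auto intro!: analytic_intros)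
      show "h 0 = deriv q 0" using dq by (simp add: h_def DERIV_imp_deriv)
    qed (auto simp: h_def q_def intro: exI[of _ 1])
    have hpos: "\<exists>y>0. h (of_real t) = of_real y" if t: "t \<noteq> 0" for t :: real
    proof -
      have "h (of_real t) = of_real ((a powr t - b powr t) / ((ln a - ln b) * t))"
        using t by (simp add: h_def q_def flip: pw)
      moreover have "(a powr t - b powr t) / ((ln a - ln b) * t) > 0"
      proof -
        have "sgn (a powr t - b powr t) = sgn ((ln a - ln b) * t)"
        proof -
          have "a powr t = exp (t * ln a)" "b powr t = exp (t * ln b)"
            using assms by (auto simp: powr_def)
          hence "sgn (a powr t - b powr t) = sgn (t * ln a - t * ln b)"
            by (simp add: sgn_if)
          thus ?thesis by (simp add: algebra_simps)
        qed
        moreover have "(ln a - ln b) * t \<noteq> 0" using k t by (simp add: k_def)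
        moreover have "u / v > 0" if "sgn u = sgn v" "v \<noteq> 0" for u v :: real
          using that by (cases "v > 0") (auto simp: sgn_if zero_less_divide_iff split: if_splits)
        ultimately show ?thesis by blast
      qed
      ultimately show ?thesis by blast
    qed
    have "\<forall>\<^sub>F t in at (0::real). t \<noteq> 0"
      by (simp add: eventually_at_filter)
    hence ev: "\<forall>\<^sub>F t in at 0. gen_apostol_genocchi_gf \<alpha> x a b c lam t =
        (\<lambda>z. of_real (1 / k) powr \<alpha> * exp (- \<alpha> * Ln (h z)) * exp (x * of_real (ln c) * z)) (of_real t)"
    proof eventually_elim
      case (elim t)
      then obtain y where y: "y > 0" "h (of_real t) = of_real y" using hpos by blast
      have qy: "exp (A * of_real t) - exp (B * of_real t) = 2 * of_real k * of_real y * of_real t"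
        using elim y(2) k by (simp add: h_def q_def field_simps flip: k2)
      have "2 * of_real t / (lam * exp (B * of_real t) + exp (A * of_real t))
          = 2 * of_real t / (exp (A * of_real t) - exp (B * of_real t))"
        by (simp add: True)
      also have "\<dots> = of_real (1 / y) * of_real (1 / k)"
        unfolding qy using elim y(1) k by (simp add: field_simps)
      also have "\<dots> powr \<alpha> = of_real (1 / y) powr \<alpha> * of_real (1 / k) powr \<alpha>"
        by (rule powr_times_real_left) (use y(1) in auto)
      also have "of_real (1 / y) powr \<alpha> = exp (- \<alpha> * Ln (h (of_real t)))"
        using y by (simp add: powr_def Ln_of_real ln_div del: of_real_divide)
      finally show ?case by (simp add: gf mult_ac)
    qed
    have "h 0 = 1" by (simp add: h_def)
    show ?thesis
      by (rule has_egf_analytic[OF _ ev])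
         (use han \<open>h 0 = 1\<close> in \<open>auto intro!: analytic_intros\<close>)
  qed
qed

end

theory Submission
  imports Defs
begin

text \<open>
  Put \<open>L = ln b - ln a\<close>.  The base of the left-hand power at \<open>t\<close>, multiplied by \<open>a powr t * L\<close>, is the
  base of the right-hand power at \<open>L * t\<close>, so the identity is the substitution \<open>t \<mapsto> L * t\<close> as soon as
  the powers of order \<open>\<alpha>\<close> split.  For \<open>L < 0\<close> this can fail, but not for \<open>lam = -1\<close>, where the
  left-hand base is positive, nor for natural \<open>\<alpha>\<close>.  In all other cases the generating functions behave
  like a multiple of \<open>t powr \<alpha>\<close> as \<open>t\<close> decreases to \<open>0\<close>, so neither has an expansion, and both sides
  are \<open>0\<close>.
\<close>

section \<open>Orders for which no expansion exists\<close>

text \<open>Replacing \<open>t\<close> by \<open>exp d * t\<close> keeps the limit but multiplies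
  the power by \<open>exp (\<kappa> * d)\<close>. A nonzero limit forces this factor to be
  1.\<close>

lemma tendsto_powr_at_right_0_imp_eq_0:
  fixes \<kappa> \<gamma> :: complex
  assumes lim: "((\<lambda>t::real. of_real t powr \<kappa>) \<longlongrightarrow> \<gamma>) (at_right 0)" and "\<gamma> \<noteq> 0"
  shows "\<kappa> = 0"
proof -
  \<comment> \<open>This makes the norm of \<open>\<kappa> * d\<close> less than 1, hence less than
    the period of \<open>exp\<close>, so \<open>exp (\<kappa> * d) = 1\<close> leaves only
    \<open>\<kappa> * d = 0\<close>.\<close>
  define d where "d = 1 / (1 + norm \<kappa>)"
  have d: "d > 0" by (simp add: d_def add_pos_nonneg)
  have "norm (\<kappa> * of_real d) = norm \<kappa> * d"
    using d by (simp add: norm_mult)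
  also have "\<dots> < 1"
    by (simp add: d_def divide_simps add_pos_nonneg)
  finally have "norm (\<kappa> * of_real d) < 1" .
  hence small: "\<bar>Im (\<kappa> * of_real d)\<bar> < 1"
    using abs_Im_le_cmod[of "\<kappa> * of_real d"] by linarith
  have "filterlim (\<lambda>t::real. exp d * t) (at_right 0) (at_right 0)"
    unfolding filterlim_at
    by (auto intro!: tendsto_eq_intros simp: eventually_at_filter)
  from filterlim_compose[OF lim this]
  have "((\<lambda>t::real. of_real (exp d * t) powr \<kappa>) \<longlongrightarrow> \<gamma>) (at_right 0)" .
  moreover have "of_real (exp d * t) powr \<kappa> = of_real (exp d) powr \<kappa> * of_real t powr \<kappa>" for t :: real
    unfolding of_real_mult by (rule powr_times_real_left) auto
  ultimately have "((\<lambda>t::real. of_real (exp d) powr \<kappa> * of_real t powr \<kappa>) \<longlongrightarrow> \<gamma>) (at_right 0)"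
    by simp
  moreover have "((\<lambda>t::real. of_real (exp d) powr \<kappa> * of_real t powr \<kappa>) \<longlongrightarrow>
      of_real (exp d) powr \<kappa> * \<gamma>) (at_right 0)"
    by (intro tendsto_intros lim)
  ultimately have "\<gamma> = of_real (exp d) powr \<kappa> * \<gamma>"
    by (rule tendsto_unique[rotated]) simp
  hence "exp (\<kappa> * of_real d) = exp 0"
    using \<open>\<gamma> \<noteq> 0\<close> by (simp add: powr_def Ln_of_real)
  hence "\<kappa> * of_real d = 0"
    by (rule exp_complex_eqI[rotated]) (use small pi_gt3 in simp)
  thus ?thesis using d by simp
qed

text \<open>A nonzero power series behaves like its first nonvanishing term. The integer exponent
  \<open>m\<close> is what the order \<alpha> is later compared with.\<close>

lemma has_egf_leading_term:
  assumes F: "has_egf F g" and nz: "\<forall>\<^sub>F t in at 0. F t \<noteq> 0"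
  obtains m l where "l \<noteq> 0" "((\<lambda>t. F t / of_real t ^ m) \<longlongrightarrow> l) (at 0)"
proof -
  define A where "A = Abs_fps (\<lambda>n. g n / fact n)"
  obtain r where r: "r > 0"
    and sums: "\<And>t. t \<noteq> 0 \<Longrightarrow> \<bar>t\<bar> < r \<Longrightarrow> (\<lambda>n. fps_nth A n * of_real t ^ n) sums F t"
    using F by (auto simp: has_egf_def eventually_at dist_norm A_def)
  have Feq: "F t = eval_fps A (of_real t)" if "t \<noteq> 0" "\<bar>t\<bar> < r / 2" for t
    using sums[of t] that r by (simp add: eval_fps_def sums_iff)
  have "conv_radius (fps_nth A) \<ge> norm (complex_of_real (r / 2))"
    by (rule conv_radius_geI) (use sums[of "r / 2"] r in \<open>auto simp: sums_iff\<close>)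
  hence rad: "ereal (r / 2) \<le> fps_conv_radius A"
    using r by (simp add: fps_conv_radius_def)
  have ev: "\<forall>\<^sub>F t in at 0. t \<noteq> 0 \<and> \<bar>t\<bar> < r / 2"
    unfolding eventually_at using r by (intro exI[of _ "r / 2"]) (auto simp: dist_norm)
  have A0: "A \<noteq> 0"
  proof
    assume "A = 0"
    have "\<forall>\<^sub>F t in at (0::real). False"
      using ev nz by eventually_elim (simp add: Feq \<open>A = 0\<close>)
    thus False by simp
  qed
  \<comment> \<open>Shifting by the subdegree divides out the zero at 0, so the value of
    \<open>S\<close> at 0 is the first nonzero coefficient of \<open>A\<close>.\<close>
  define m where "m = subdegree A"
  define S where "S = fps_shift m A"
  have "isCont (eval_fps S) 0"
    using less_le_trans[OF _ rad, of 0] r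
    by (intro continuous_eval_fps) (auto simp: S_def zero_ereal_def)
  hence "((\<lambda>t::real. eval_fps S (of_real t)) \<longlongrightarrow> eval_fps S 0) (at 0)"
    by (intro isCont_tendsto_compose[of _ "eval_fps S"]) (auto intro!: tendsto_eq_intros)
  moreover have "\<forall>\<^sub>F t in at 0. eval_fps S (of_real t) = F t / of_real t ^ m"
    using ev
  proof eventually_elim
    case (elim t)
    have "ereal (norm (complex_of_real t)) < fps_conv_radius A"
      by (rule less_le_trans[OF _ rad]) (use elim in simp)
    thus ?case
      using elim by (simp add: Feq S_def m_def eval_fps_shift)
  qed
  ultimately have "((\<lambda>t. F t / of_real t ^ m) \<longlongrightarrow> eval_fps S 0) (at 0)"
    by (rule Lim_transform_eventually)
  moreover have "eval_fps S 0 \<noteq> 0"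
    using A0 by (simp add: S_def m_def eval_fps_at_0)
  ultimately show ?thesis using that by blast
qed

lemma gen_apostol_genocchi_denominator_tendsto:
  fixes lam :: complex
  assumes "a > 0" "b > 0"
  shows "((\<lambda>t. lam * of_real (b powr t) + of_real (a powr t)) \<longlongrightarrow> lam + 1) (at (0::real))"
proof -
  have "((\<lambda>t. lam * of_real (b powr t) + of_real (a powr t)) \<longlongrightarrow>
      lam * of_real (b powr 0) + of_real (a powr 0)) (at (0::real))"
    by (intro tendsto_intros) (use assms in auto)
  thus ?thesis using assms by simp
qed

text \<open>Continuity of the principal power does not suffice: for real \<open>lam < -1\<close> the
  limit of the base lies on the branch cut. For real \<open>lam\<close>, however, the base moves
  along the real line and stays on one side of 0.\<close>

lemma tendsto_powr_gen_apostol_genocchi_base: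
  fixes lam \<alpha> :: complex
  assumes "a > 0" "b > 0" "lam \<noteq> -1"
  shows "((\<lambda>t::real. (2 / (lam * of_real (b powr t) + of_real (a powr t))) powr \<alpha>) \<longlongrightarrow>
    (2 / (lam + 1)) powr \<alpha>) (at 0)"
proof -
  have lam: "lam + 1 \<noteq> 0" using assms(3) by (simp add: add_eq_0_iff2)
  note den = gen_apostol_genocchi_denominator_tendsto[OF assms(1,2), of lam]
  show ?thesis
  proof (cases "lam \<in> \<real>")
    case False
    have "2 / (lam + 1) \<notin> \<real>\<^sub>\<le>\<^sub>0"
    proof
      assume "2 / (lam + 1) \<in> \<real>\<^sub>\<le>\<^sub>0"
      then obtain s where s: "2 / (lam + 1) = of_real s"
        by (auto elim: nonpos_Reals_cases)
      hence "s \<noteq> 0" using lam by auto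
      hence "lam = of_real (2 / s - 1)"
        using lam s by (simp add: field_simps)
      thus False using False by simp
    qed
    thus ?thesis
      by (rule tendsto_powr_complex) (auto intro!: tendsto_intros den lam)
  next
    case True
    then obtain l where l: "lam = of_real l" by (auto elim: Reals_cases)
    have l1: "l + 1 \<noteq> 0" using lam unfolding l by (metis of_real_0 of_real_1 of_real_add)
    \<comment> \<open>The ratio of the base to its limit. It is real and tends to 1, so it is
      eventually positive and splits off the power even on the cut.\<close>
    define e where "e t = (l + 1) / (l * b powr t + a powr t)" for t
    have "((\<lambda>t. l * b powr t + a powr t) \<longlongrightarrow> l + 1) (at (0::real))"
      using tendsto_Re[OF den] by (simp add: l)
    hence e: "(e \<longlongrightarrow> 1) (at 0)"
      unfolding e_def using tendsto_divide[OF tendsto_const] l1 by (metis divide_self)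
    have "((\<lambda>t. of_real (e t) powr \<alpha> * (2 / (lam + 1)) powr \<alpha>) \<longlongrightarrow>
        of_real 1 powr \<alpha> * (2 / (lam + 1)) powr \<alpha>) (at 0)"
      by (intro tendsto_mult tendsto_const tendsto_powr_complex tendsto_of_real e) auto
    moreover have "\<forall>\<^sub>F t in at 0. e t > 0"
      using order_tendstoD(1)[OF e] by simp
    hence "\<forall>\<^sub>F t in at 0. of_real (e t) powr \<alpha> * (2 / (lam + 1)) powr \<alpha> =
        (2 / (lam * of_real (b powr t) + of_real (a powr t))) powr \<alpha>"
    proof eventually_elim
      case (elim t)
      have "2 / (lam * of_real (b powr t) + of_real (a powr t)) = of_real (e t) * (2 / (lam + 1))"
      proof -
        have e': "of_real (e t) = (lam + 1) / (lam * of_real (b powr t) + of_real (a powr t))"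
          by (simp add: e_def l)
        have "2 / d = p / d * (2 / p)" if "p \<noteq> 0" for p d :: complex
          using that by simp
        from this[OF lam] show ?thesis unfolding e' .
      qed
      moreover have "(of_real (e t) * (2 / (lam + 1))) powr \<alpha> =
          of_real (e t) powr \<alpha> * (2 / (lam + 1)) powr \<alpha>"
        by (rule powr_times_real_left) (use elim in auto)
      ultimately show ?case by simp
    qed
    ultimately show ?thesis
      using Lim_transform_eventually by force
  qed
qed

text \<open>For small \<open>t > 0\<close> the function equals \<open>t powr \<alpha> * H t\<close>,
  where \<open>H\<close> has a nonzero limit. An expansion makes it comparable to some
  \<open>t ^ m\<close>, so \<open>t powr (\<alpha> - m)\<close> has a nonzero limit and \<alpha> is
  \<open>m\<close>.\<close>

lemma has_egf_gen_apostol_genocchi_imp: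
  assumes "a > 0" "b > 0" "c > 0" "lam \<noteq> -1"
    and egf: "has_egf (gen_apostol_genocchi_gf \<alpha> x a b c lam) g"
  shows "\<alpha> \<in> \<nat>"
proof -
  define F where "F = gen_apostol_genocchi_gf \<alpha> x a b c lam"
  define den where "den t = lam * of_real (b powr t) + of_real (a powr t)" for t :: real
  define H where "H t = (2 / den t) powr \<alpha> * of_real c powr (x * of_real t)" for t
  define \<beta> where "\<beta> = (2 / (lam + 1)) powr \<alpha>"
  have lam: "lam + 1 \<noteq> 0" using assms by (simp add: add_eq_0_iff2)
  have \<beta>: "\<beta> \<noteq> 0" using lam by (simp add: \<beta>_def)
  have cx: "of_real c powr (x * of_real t) = exp (x * of_real (ln c) * of_real t)" for t :: real
    using assms by (simp add: powr_def Ln_of_real mult_ac)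
  have "(H \<longlongrightarrow> \<beta> * exp (x * of_real (ln c) * of_real 0)) (at 0)"
    unfolding H_def \<beta>_def den_def cx
    by (intro tendsto_mult[OF tendsto_powr_gen_apostol_genocchi_base] tendsto_intros assms)
  hence H: "(H \<longlongrightarrow> \<beta>) (at 0)" by simp
  have "\<forall>\<^sub>F t in at 0. den t \<noteq> 0"
    unfolding den_def
    by (rule tendsto_imp_eventually_ne[OF gen_apostol_genocchi_denominator_tendsto lam])
       (use assms in auto)
  moreover have "\<forall>\<^sub>F t in at (0::real). t \<noteq> 0"
    by (simp add: eventually_at_filter)
  ultimately have "\<forall>\<^sub>F t in at 0. F t \<noteq> 0"
    by eventually_elim
       (use assms in \<open>auto simp: F_def gen_apostol_genocchi_gf_def den_def\<close>)
  then obtain m l where l: "l \<noteq> 0" and lim: "((\<lambda>t. F t / of_real t ^ m) \<longlongrightarrow> l) (at 0)"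
    using has_egf_leading_term egf unfolding F_def by blast
  have "\<forall>\<^sub>F t in at 0. H t \<noteq> 0"
    by (rule tendsto_imp_eventually_ne[OF H \<beta>])
  hence "\<forall>\<^sub>F t in at_right 0. H t \<noteq> 0"
    by (rule filter_leD[OF at_le, rotated]) simp
  moreover have "\<forall>\<^sub>F t in at_right (0::real). t > 0"
    by (rule eventually_at_right_less)
  ultimately have "\<forall>\<^sub>F t in at_right 0. (F t / of_real t ^ m) / H t = of_real t powr (\<alpha> - of_nat m)"
  proof eventually_elim
    case (elim t)
    have "F t = (of_real t * (2 / den t)) powr \<alpha> * of_real c powr (x * of_real t)"
      by (simp add: F_def gen_apostol_genocchi_gf_def den_def mult_ac)
    \<comment> \<open>The one-sided filter matters here: a positive real factor always splits off a
      principal power, a negative one need not.\<close>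
    also have "(of_real t * (2 / den t)) powr \<alpha> = of_real t powr \<alpha> * (2 / den t) powr \<alpha>"
      by (rule powr_times_real_left) (use elim in auto)
    finally have "F t = of_real t powr \<alpha> * H t"
      by (simp add: H_def mult_ac)
    thus ?case
      using elim by (simp add: powr_diff powr_nat)
  qed
  moreover have "((\<lambda>t. (F t / of_real t ^ m) / H t) \<longlongrightarrow> l / \<beta>) (at_right 0)"
    by (rule tendsto_divide)
       (use tendsto_mono[OF at_le[of "{0<..}" UNIV]] lim H \<beta> in auto)
  ultimately have "((\<lambda>t::real. of_real t powr (\<alpha> - of_nat m)) \<longlongrightarrow> l / \<beta>) (at_right 0)"
    using Lim_transform_eventually by force
  hence "\<alpha> - of_nat m = 0"
    by (rule tendsto_powr_at_right_0_imp_eq_0) (use l \<beta> in auto)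
  thus ?thesis by simp
qed

section \<open>Rescaling the generating function\<close>

lemma powr_mult_real_or_nat:
  fixes w \<alpha> :: complex
  assumes "L > 0 \<or> w \<in> \<real> \<and> Re w > 0 \<or> \<alpha> \<in> \<nat>" "L \<noteq> 0"
  shows "(of_real L * w) powr \<alpha> = of_real L powr \<alpha> * w powr \<alpha>"
  using assms(1)
proof (elim disjE conjE)
  assume "\<alpha> \<in> \<nat>"
  then obtain m where "\<alpha> = of_nat m" by (auto elim: Nats_cases)
  thus ?thesis using assms(2) by (simp add: powr_nat power_mult_distrib)
next
  assume "w \<in> \<real>" "Re w > 0"
  thus ?thesis using powr_times_real_left[of w "of_real L" \<alpha>] by (simp add: mult.commute)
qed (auto intro!: powr_times_real_left)

text \<open>Factoring \<open>a powr t\<close> out of the denominator leaves the standard one at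
  \<open>L * t\<close>. The power \<alpha> of this factor is an exponential, which the shift by
  \<open>- \<alpha> * ln a\<close> in the argument cancels.\<close>

lemma gen_apostol_genocchi_gf_rescale:
  fixes \<alpha> x lam :: complex
  assumes "a > 0" "b > 0" "c > 0" "a \<noteq> b" "\<alpha> \<in> \<nat> \<or> lam = -1" "t \<noteq> 0"
  defines "L \<equiv> ln b - ln a"
  shows "gen_apostol_genocchi_gf \<alpha> x a b c lam t = of_real L powr (- \<alpha>) *
    apostol_genocchi_gf \<alpha> ((- \<alpha> * of_real (ln a) + x * of_real (ln c)) / of_real L) lam (L * t)"
proof -
  have L: "L \<noteq> 0" using assms by (simp add: L_def)
  define B where "B = 2 * of_real t / (lam * of_real (b powr t) + of_real (a powr t))"
  have "b powr t = a powr t * exp (L * t)"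
    using assms by (simp add: L_def powr_def field_simps flip: exp_add)
  hence "complex_of_real (b powr t) = of_real (a powr t) * exp (of_real (L * t))"
    by (simp only: exp_of_real flip: of_real_mult)
  hence "lam * of_real (b powr t) + of_real (a powr t) =
      of_real (a powr t) * (lam * exp (of_real (L * t)) + 1)"
    by (simp only:) (simp add: algebra_simps)
  hence base: "2 * of_real (L * t) / (lam * exp (of_real (L * t)) + 1) =
      of_real (a powr t) * (of_real L * B)"
    using assms by (simp add: B_def)
  \<comment> \<open>A negative \<open>L\<close> could spoil the splitting below. Here
    \<open>a > b\<close>, so \<open>a powr t - b powr t\<close> has the sign of \<open>t\<close> and
    \<open>B\<close> is a positive real.\<close>
  have "B \<in> \<real> \<and> Re B > 0" if "lam = -1" "\<not> L > 0"
  proof -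
    have "B = of_real (2 * t / (a powr t - b powr t))"
      by (simp add: B_def that)
    moreover have "a > b" using that L assms by (simp add: L_def)
    hence "2 * t / (a powr t - b powr t) > 0"
      using assms powr_less_mono2[of t b a] powr_less_mono2_neg[of t b a]
      by (cases "t > 0") (auto simp: zero_less_divide_iff)
    ultimately show ?thesis by simp
  qed
  hence split: "(of_real L * B) powr \<alpha> = of_real L powr \<alpha> * B powr \<alpha>"
    using assms(5) by (intro powr_mult_real_or_nat L) auto
  have "(2 * of_real (L * t) / (lam * exp (of_real (L * t)) + 1)) powr \<alpha> =
      of_real (a powr t) powr \<alpha> * (of_real L powr \<alpha> * B powr \<alpha>)"
    unfolding base split[symmetric] by (rule powr_times_real_left) auto
  also have "complex_of_real (a powr t) powr \<alpha> = exp (\<alpha> * of_real (ln a) * of_real t)"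
    using assms by (simp add: powr_def Ln_of_real mult_ac)
  finally have "apostol_genocchi_gf \<alpha>
      ((- \<alpha> * of_real (ln a) + x * of_real (ln c)) / of_real L) lam (L * t) =
      of_real L powr \<alpha> * B powr \<alpha> * (exp (\<alpha> * of_real (ln a) * of_real t) *
        exp ((- \<alpha> * of_real (ln a) + x * of_real (ln c)) / of_real L * of_real (L * t)))"
    by (simp add: apostol_genocchi_gf_def mult_ac)
  also have "exp (\<alpha> * of_real (ln a) * of_real t) *
        exp ((- \<alpha> * of_real (ln a) + x * of_real (ln c)) / of_real L * of_real (L * t)) =
      of_real c powr (x * of_real t)"
  proof -
    have "p / of_real L * of_real (L * t) = p * of_real t" for p :: complex
      using L by simp
    thus ?thesis
      using assms(3) by (simp only: powr_def Ln_of_real flip: exp_add) (simp add: algebra_simps)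
  qed
  finally show ?thesis
    using L by (simp add: gen_apostol_genocchi_gf_def B_def powr_minus)
qed

lemma has_egf_rescale:
  assumes "has_egf F g" "L \<noteq> 0" "\<forall>\<^sub>F t in at 0. G t = k * F (L * t)"
  shows "has_egf G (\<lambda>n. k * of_real L ^ n * g n)"
proof -
  have "filterlim (\<lambda>t. L * t) (at 0) (at 0)"
    unfolding filterlim_at using assms(2)
    by (auto intro!: tendsto_eq_intros simp: eventually_at_filter)
  from eventually_compose_filterlim[OF assms(1)[unfolded has_egf_def] this] assms(3)
  show ?thesis
    unfolding has_egf_def
  proof eventually_elim
    case (elim t)
    from sums_mult[OF elim(1), of k] show ?case
      by (simp add: elim(2) power_mult_distrib mult_ac)
  qed
qed

theorem theorem3p2:
  fixes a b c x :: real and n :: nat and \<alpha> lam :: complex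
  assumes "a > 0" and "b > 0" and "c > 0" and "a \<noteq> b"
  shows "gen_apostol_genocchi n \<alpha> (of_real x) a b c lam =
    apostol_genocchi n \<alpha>
      ((- \<alpha> * of_real (ln a) + of_real x * of_real (ln c)) / of_real (ln b - ln a)) lam
    * of_real (ln b - ln a) powr (of_nat n - \<alpha>)"
proof -
  define L where "L = ln b - ln a"
  define X where "X = (- \<alpha> * of_real (ln a) + of_real x * of_real (ln c)) / of_real L"
  have L: "L \<noteq> 0" using assms by (simp add: L_def)
  have "gen_apostol_genocchi n \<alpha> (of_real x) a b c lam =
    apostol_genocchi n \<alpha> X lam * of_real L powr (of_nat n - \<alpha>)"
  proof (cases "\<alpha> \<in> \<nat> \<or> lam = -1")
    case True
    \<comment> \<open>The standard generating function is the instance \<open>a = 1\<close>,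
      \<open>b = c = exp 1\<close>, so the general existence result covers it.\<close>
    obtain g where g: "has_egf (apostol_genocchi_gf \<alpha> X lam) g"
      using gen_apostol_genocchi_expansion[of 1 "exp 1" "exp 1" \<alpha> lam X] True
      by (auto simp: gen_apostol_genocchi_gf_standard)
    have "\<forall>\<^sub>F t in at (0::real). t \<noteq> 0"
      by (simp add: eventually_at_filter)
    hence "\<forall>\<^sub>F t in at 0. gen_apostol_genocchi_gf \<alpha> (of_real x) a b c lam t =
        of_real L powr (- \<alpha>) * apostol_genocchi_gf \<alpha> X lam (L * t)"
      unfolding X_def L_def
      by eventually_elim (rule gen_apostol_genocchi_gf_rescale[OF assms True])
    \<comment> \<open>The coefficient factor is \<open>L powr (- \<alpha>) * L ^ n\<close>. As
      \<open>L\<close> is nonzero, also when negative, this is the principal power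
      \<open>L powr (n - \<alpha>)\<close>.\<close>
    from egf_coeff_eqI[OF has_egf_rescale[OF g L this]] egf_coeff_eqI[OF g] L
    show ?thesis
      by (simp add: gen_apostol_genocchi_def apostol_genocchi_def powr_diff powr_minus powr_nat
          field_simps)
  next
    case False
    \<comment> \<open>Stated for arbitrary parameters so that it rules out both generating
      functions. \<open>egf_coeff\<close> then takes its default 0 on each side.\<close>
    hence "\<not> (\<exists>g. has_egf (gen_apostol_genocchi_gf \<alpha> y a b c lam) g)"
      if "a > 0" "b > 0" "c > 0" for a b c y
      using has_egf_gen_apostol_genocchi_imp that by blast
    from this[of a b c "of_real x"] this[of 1 "exp 1" "exp 1" X] assms
    show ?thesis
      by (simp add: gen_apostol_genocchi_def apostol_genocchi_def egf_coeff_def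
          gen_apostol_genocchi_gf_standard)
  qed
  thus ?thesis by (simp only: X_def L_def)
qed

end
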